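(* For all integers $n\ge 1$, $$D\,T_n(x,s,q)=[n]\,U_{n-1}(x,s,q).$$
   Context: Here $x,s,q$ are indeterminates. $D$ is the $q$-differentiation operator with respect to $x$, $Df(x)=\frac{f(x)-f(qx)}{x-qx}$. Notation: $(a;q)_n=\prod_{j=0}^{n-1}(1-q^ja)$; $\begin{bmatrix} n\\k\end{bmatrix}=\frac{(q;q)_n}{(q;q)_k(q;q)_{n-k}}$ for $0\le k\le n$; $[n]=\frac{1-q^n}{1-q}$. The $q$-Chebyshev polynomials of the second kind are, for $n\ge0$, $$U_n(x,s,q)=\sum_{k=0}^{\lfloor n/2\rfloor}q^{k^2}\begin{bmatrix} n-k\\k\end{bmatrix}(1+q^{k+1})\cdots(1+q^{n-k})\,s^kx^{n-2k}.$$ The $q$-Chebyshev polynomials of the first kind are $T_0(x,s,q)=1$ and, for $n>0$, $$T_n(x,s,q)=\sum_{k=0}^{\lfloor n/2\rfloor}q^{k^2}\frac{[n]}{[n-k]}\begin{bmatrix} n-k\\k\end{bmatrix}\frac{(-q;q)_{n-1}}{(-q;q)_k\,(-q^{n-k};q)_k}\,s^kx^{n-2k}.$$ *)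

theory Defs
  imports "HOL-Computational_Algebra.Computational_Algebra"
begin

definition q_pochhammer :: "'a::field \<Rightarrow> 'a \<Rightarrow> nat \<Rightarrow> 'a" where
  "q_pochhammer a q n = (\<Prod>j<n. 1 - q ^ j * a)"

definition q_binomial :: "'a::field \<Rightarrow> nat \<Rightarrow> nat \<Rightarrow> 'a" where
  "q_binomial q n k = q_pochhammer q q n / (q_pochhammer q q k * q_pochhammer q q (n - k))"

definition q_bracket :: "'a::field \<Rightarrow> nat \<Rightarrow> 'a" where
  "q_bracket q n = (1 - q ^ n) / (1 - q)"

text \<open>
  Polynomials in the indeterminates \<open>x\<close> and \<open>s\<close> over a field \<open>'a\<close> have type
  \<open>'a poly poly\<close>; the outer variable is \<open>x\<close> and the inner one is \<open>s\<close>.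
  The indeterminate \<open>q\<close> is the generator of the rational function field
  \<open>'k poly fract\<close>, which serves as \<open>'a\<close>.
\<close>

definition q_var :: "'k::field poly fract" where
  "q_var = to_fract [:0, 1:]"

definition x_var :: "'a::field poly poly" where
  "x_var = [:0, 1:]"

definition s_var :: "'a::field poly poly" where
  "s_var = [:[:0, 1:]:]"

definition scalar :: "'a::field \<Rightarrow> 'a poly poly" where
  "scalar c = [:[:c:]:]"

definition q_chebyshev_U :: "'a::field \<Rightarrow> nat \<Rightarrow> 'a poly poly" where
  "q_chebyshev_U q n =
     (\<Sum>k = 0..n div 2.
        scalar (q ^ (k ^ 2) * q_binomial q (n - k) k * (\<Prod>j = k + 1..n - k. 1 + q ^ j))
        * s_var ^ k * x_var ^ (n - 2 * k))"

definition q_chebyshev_T :: "'a::field \<Rightarrow> nat \<Rightarrow> 'a poly poly" where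
  "q_chebyshev_T q n =
     (if n = 0 then 1
      else \<Sum>k = 0..n div 2.
        scalar (q ^ (k ^ 2) * (q_bracket q n / q_bracket q (n - k)) * q_binomial q (n - k) k
                * (q_pochhammer (- q) q (n - 1)
                   / (q_pochhammer (- q) q k * q_pochhammer (- (q ^ (n - k))) q k)))
        * s_var ^ k * x_var ^ (n - 2 * k))"

text \<open>
  The \<open>q\<close>-differentiation operator with respect to \<open>x\<close>. The polynomial \<open>f(qx)\<close> is
  \<open>f\<close> composed with \<open>qx\<close>. The operation \<open>div\<close> is division in the polynomial ring,
  which is exact here: see \<open>q_diff_exact\<close> below.
\<close>

definition q_diff :: "'a::field \<Rightarrow> 'a poly poly \<Rightarrow> 'a poly poly" where
  "q_diff q f = (f - pcompose f (scalar q * x_var)) div (x_var - scalar q * x_var)"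

lemma q_diff_exact:
  fixes f :: "'a::field poly poly"
  assumes "q \<noteq> 1"
  shows "q_diff q f * (x_var - scalar q * x_var) = f - pcompose f (scalar q * x_var)"
proof -
  have eq: "x_var - scalar q * x_var = [:[:1 - q:]:] * ([:0, 1:] :: 'a poly poly)"
    by (simp add: x_var_def scalar_def one_pCons)
  have unit: "[:[:1 - q:]:] dvd (1 :: 'a poly poly)"
    using assms by (simp add: is_unit_const_poly_iff dvd_field_iff)
  have "poly (f - pcompose f (scalar q * x_var)) 0 = 0"
    by (simp add: poly_pcompose scalar_def x_var_def)
  then have "[:0, 1:] dvd f - pcompose f (scalar q * x_var)"
    by (simp only: poly_eq_0_iff_dvd minus_zero)
  then have "x_var - scalar q * x_var dvd f - pcompose f (scalar q * x_var)"
    by (simp only: eq mult_unit_dvd_iff'[OF unit])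
  then show ?thesis
    unfolding q_diff_def by (rule dvd_div_mult_self)
qed

lemma q_var_neq_1: "(q_var :: 'k::field poly fract) \<noteq> 1"
proof -
  have "([:0, 1:] :: 'k poly) \<noteq> 1"
    by (simp add: one_pCons)
  then have "to_fract [:0, 1:] \<noteq> to_fract (1 :: 'k poly)"
    by (simp only: to_fract_eq_iff not_False_eq_True)
  then show ?thesis
    by (simp add: q_var_def)
qed

end

theory Submission
  imports Defs
begin

text \<open>
  Both sides are sums over \<open>k\<close> of monomials in \<open>s\<close> and \<open>x\<close>, and \<open>D\<close> sends \<open>x\<^sup>m\<close> to
  \<open>[m] x\<^sup>m\<^sup>-\<^sup>1\<close> and is linear over the coefficients in \<open>s\<close>. So the identity is one about
  coefficients, for each \<open>k\<close> with \<open>2k < n\<close>; the last term \<open>2k = n\<close> of \<open>T\<^sub>n\<close>, present for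
  even \<open>n\<close>, is free of \<open>x\<close> and is annihilated. The coefficients agree for two reasons.

  First, the factor \<open>[n-2k]\<close> that \<open>D\<close> produces and the denominator \<open>[n-k]\<close> in \<open>T\<^sub>n\<close> lower
  the Gaussian binomial coefficient from \<open>n-k\<close> over \<open>k\<close> to \<open>n-1-k\<close> over \<open>k\<close>
  (\<open>q_binomial_absorb\<close>). Second, in the quotient of the symbols with argument \<open>-q\<close>, the
  numerator is the product of \<open>1 + q\<^sup>j\<close> over \<open>1 \<le> j < n\<close>, and the denominator removes the
  first \<open>k\<close> and the last \<open>k\<close> of these factors. The block that survives, \<open>k < j < n-k\<close>, is
  the product that appears in \<open>U\<^sub>n\<^sub>-\<^sub>1\<close> (\<open>q_pochhammer_middle_block\<close>).

  All divisions are legitimate as soon as no positive power of \<open>q\<close> equals \<open>1\<close>: then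
  \<open>1 + q\<^sup>j \<noteq> 0\<close> as well, since \<open>q\<^sup>j = -1\<close> would give \<open>q\<^sup>2\<^sup>j = 1\<close>. The argument is
  therefore carried out for any such element of a field, of which the indeterminate is an
  instance.
\<close>

section \<open>The q-derivative of polynomials\<close>

lemma scalar_0: "scalar 0 = 0"
  by (simp add: scalar_def)

lemma scalar_1: "scalar 1 = 1"
  by (simp add: scalar_def one_pCons)

lemma scalar_mult: "scalar (a * b) = scalar a * scalar b"
  by (simp add: scalar_def)

lemma scalar_power: "scalar (a ^ n) = scalar a ^ n"
  by (induction n) (simp_all add: scalar_mult scalar_1)

lemma scalar_diff: "scalar (a - b) = scalar a - scalar b"
  by (simp add: scalar_def)

lemma q_diff_denominator_nonzero:
  assumes "q \<noteq> (1 :: 'a::field)"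
  shows "x_var - scalar q * x_var \<noteq> (0 :: 'a poly poly)"
  using assms by (simp add: x_var_def scalar_def one_pCons)

lemma q_diff_eqI:
  fixes q :: "'a::field"
  assumes "q \<noteq> 1" and "g * (x_var - scalar q * x_var) = f - pcompose f (scalar q * x_var)"
  shows "q_diff q f = g"
  unfolding q_diff_def assms(2)[symmetric]
  using q_diff_denominator_nonzero[OF assms(1)] by simp

lemma q_diff_sum:
  fixes q :: "'a::field"
  assumes "q \<noteq> 1"
  shows "q_diff q (\<Sum>k\<in>A. f k) = (\<Sum>k\<in>A. q_diff q (f k))"
  by (rule q_diff_eqI[OF assms])
    (simp add: sum_distrib_right q_diff_exact[OF assms] pcompose_sum sum_subtractf)

lemma q_diff_monomial:
  fixes q :: "'a::field"
  assumes "q \<noteq> 1"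
  shows "q_diff q (scalar c * s_var ^ k * x_var ^ m)
         = scalar (c * q_bracket q m) * s_var ^ k * x_var ^ (m - 1)"
proof (rule q_diff_eqI[OF assms])
  have comp_s: "pcompose (s_var ^ k) p = s_var ^ k" for p :: "'a poly poly"
  proof (induction k)
    case (Suc k)
    have "pcompose s_var p = s_var"
      by (simp add: s_var_def)
    with Suc show ?case
      by (simp add: pcompose_mult)
  qed (simp add: pcompose_1)
  have comp_x: "pcompose (x_var ^ m) p = p ^ m" for p :: "'a poly poly"
    by (induction m) (simp_all add: pcompose_mult x_var_def pcompose_pCons pcompose_1)
  have comp_c: "pcompose (scalar c) p = scalar c" for p
    by (simp add: scalar_def)
  have rhs: "scalar c * s_var ^ k * x_var ^ m
        - pcompose (scalar c * s_var ^ k * x_var ^ m) (scalar q * x_var)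
      = scalar c * (1 - scalar (q ^ m)) * s_var ^ k * x_var ^ m"
    by (simp add: pcompose_mult comp_s comp_x comp_c power_mult_distrib scalar_power algebra_simps)
  show "scalar (c * q_bracket q m) * s_var ^ k * x_var ^ (m - 1) * (x_var - scalar q * x_var)
      = scalar c * s_var ^ k * x_var ^ m
        - pcompose (scalar c * s_var ^ k * x_var ^ m) (scalar q * x_var)"
  proof (cases m)
    case 0
    then show ?thesis
      unfolding rhs by (simp add: q_bracket_def scalar_0 scalar_1)
  next
    case (Suc l)
    have "scalar (q_bracket q m) * (1 - scalar q) = 1 - scalar (q ^ m)"
      using assms
      by (simp add: scalar_mult[symmetric] scalar_diff[symmetric] scalar_1[symmetric] q_bracket_def)
    then have "scalar c * (1 - scalar (q ^ m)) * s_var ^ k * x_var ^ m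
        = scalar c * (scalar (q_bracket q m) * (1 - scalar q)) * s_var ^ k * x_var ^ m"
      by simp
    then show ?thesis
      unfolding rhs using Suc by (simp add: scalar_mult algebra_simps)
  qed
qed

section \<open>The coefficient identities\<close>

lemma q_pochhammer_Suc: "q_pochhammer a q (Suc n) = q_pochhammer a q n * (1 - q ^ n * a)"
  by (simp add: q_pochhammer_def)

lemma q_pochhammer_neg_power:
  "q_pochhammer (- (q ^ i)) q k = (\<Prod>j = i..<i + k. 1 + q ^ j)"
  by (induction k) (simp_all add: q_pochhammer_def power_add mult.commute)

lemma q_pochhammer_neg: "q_pochhammer (- q) q k = (\<Prod>j = 1..<1 + k. 1 + q ^ j)"
  using q_pochhammer_neg_power[of q 1 k] by simp

text \<open>The \<open>q\<close>-analogue of \<open>(m+1-k) \<cdot> binomial (m+1) k = (m+1) \<cdot> binomial m k\<close>.\<close>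

lemma q_binomial_absorb:
  fixes q :: "'a::field"
  assumes "\<And>i. i \<ge> 1 \<Longrightarrow> q ^ i \<noteq> 1" and "k \<le> m"
  shows "q_binomial q (Suc m) k * q_bracket q (Suc m - k)
         = q_bracket q (Suc m) * q_binomial q m k"
proof -
  have factor: "1 - q ^ j * q \<noteq> 0" for j
    using assms(1)[of "Suc j"] by (simp add: mult.commute)
  have nonzero: "q_pochhammer q q j \<noteq> 0" for j
    using factor by (simp add: q_pochhammer_def)
  have "1 - q \<noteq> 0"
    using factor[of 0] by simp
  then show ?thesis
    using factor[of "m - k"] nonzero assms(2)
    by (simp add: q_binomial_def q_bracket_def q_pochhammer_Suc Suc_diff_le mult.commute
        divide_simps)
qed

lemma one_plus_power_nonzero:
  fixes q :: "'a::field"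
  assumes "\<And>i. i \<ge> 1 \<Longrightarrow> q ^ i \<noteq> 1" and "j \<ge> 1"
  shows "1 + q ^ j \<noteq> 0"
proof
  assume "1 + q ^ j = 0"
  then have "q ^ j = - 1"
    by (simp add: add_eq_0_iff)
  then have "q ^ (j + j) = 1"
    by (simp add: power_add)
  then show False
    using assms(1)[of "j + j"] assms(2) by simp
qed

text \<open>
  The denominator consists of the \<open>k\<close> lowest and the \<open>k\<close> highest of the factors
  \<open>1 + q, \<dots>, 1 + q\<^sup>n\<^sup>-\<^sup>1\<close>; these two blocks are disjoint because \<open>2 * k < n\<close>.
\<close>

lemma q_pochhammer_middle_block:
  fixes q :: "'a::field"
  assumes "\<And>i. i \<ge> 1 \<Longrightarrow> q ^ i \<noteq> 1" and "2 * k < n"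
  shows "q_pochhammer (- q) q (n - 1)
           / (q_pochhammer (- q) q k * q_pochhammer (- (q ^ (n - k))) q k)
         = (\<Prod>j = k + 1..n - 1 - k. 1 + q ^ j)"
proof -
  let ?P = "\<lambda>a b. \<Prod>j = a..<b. 1 + q ^ j"
  have nonzero: "?P a b \<noteq> 0" if "a \<ge> 1" for a b
    using one_plus_power_nonzero[OF assms(1)] that by simp
  have "?P 1 n = ?P 1 (n - k) * ?P (n - k) n"
    using assms(2) by (intro prod.atLeastLessThan_concat[symmetric]) simp_all
  also have "?P 1 (n - k) = ?P 1 (1 + k) * ?P (1 + k) (n - k)"
    using assms(2) by (intro prod.atLeastLessThan_concat[symmetric]) simp_all
  finally have "?P 1 n = ?P 1 (1 + k) * ?P (1 + k) (n - k) * ?P (n - k) n" .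
  moreover have "{k + 1..n - 1 - k} = {1 + k..<n - k}"
    using assms(2) by auto
  moreover have "1 + (n - 1) = n" "n - k + k = n"
    using assms(2) by simp_all
  ultimately show ?thesis
    using nonzero[of 1 "1 + k"] nonzero[of "n - k" n] assms(2)
    unfolding q_pochhammer_neg q_pochhammer_neg_power by simp
qed

section \<open>Differentiating the polynomials of the first kind\<close>

theorem q_diff_q_chebyshev_T:
  fixes q :: "'a::field"
  assumes nonroot: "\<And>i. i \<ge> 1 \<Longrightarrow> q ^ i \<noteq> 1" and "n \<ge> 1"
  shows "q_diff q (q_chebyshev_T q n) = scalar (q_bracket q n) * q_chebyshev_U q (n - 1)"
proof -
  have q1: "q \<noteq> 1"
    using nonroot[of 1] by simp
  define t where "t k = q ^ (k ^ 2) * (q_bracket q n / q_bracket q (n - k)) * q_binomial q (n - k) k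
                * (q_pochhammer (- q) q (n - 1)
                   / (q_pochhammer (- q) q k * q_pochhammer (- (q ^ (n - k))) q k))" for k
  define u where "u k = q ^ (k ^ 2) * q_binomial q (n - 1 - k) k
                * (\<Prod>j = k + 1..n - 1 - k. 1 + q ^ j)" for k
  have coeff: "t k * q_bracket q (n - 2 * k) = q_bracket q n * u k" if k: "2 * k < n" for k
  proof -
    have "q_bracket q (n - k) \<noteq> 0"
      using nonroot[of "n - k"] q1 k by (simp add: q_bracket_def)
    moreover have "q_binomial q (n - k) k * q_bracket q (n - 2 * k)
        = q_bracket q (n - k) * q_binomial q (n - 1 - k) k"
    proof -
      have "n - k = Suc (n - 1 - k)" "k \<le> n - 1 - k" "n - 2 * k = n - k - k"
        using k by simp_all
      then show ?thesis
        using q_binomial_absorb[OF nonroot, of k "n - 1 - k"] by simp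
    qed
    ultimately have binomial: "q_bracket q n / q_bracket q (n - k)
          * (q_binomial q (n - k) k * q_bracket q (n - 2 * k))
        = q_bracket q n * q_binomial q (n - 1 - k) k"
      by simp
    have block: "q_pochhammer (- q) q (n - 1)
          / (q_pochhammer (- q) q k * q_pochhammer (- (q ^ (n - k))) q k)
        = (\<Prod>j = k + 1..n - 1 - k. 1 + q ^ j)"
      using nonroot k by (rule q_pochhammer_middle_block)
    have "t k * q_bracket q (n - 2 * k)
        = q ^ (k ^ 2) * (q_bracket q n / q_bracket q (n - k)
            * (q_binomial q (n - k) k * q_bracket q (n - 2 * k)))
          * (\<Prod>j = k + 1..n - 1 - k. 1 + q ^ j)"
      unfolding t_def block by (simp only: ac_simps)
    then show ?thesis
      unfolding binomial u_def by (simp only: ac_simps)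
  qed
  have "q_diff q (q_chebyshev_T q n)
      = (\<Sum>k = 0..n div 2. scalar (t k * q_bracket q (n - 2 * k)) * s_var ^ k
           * x_var ^ (n - 2 * k - 1))"
    using assms(2) by (simp add: q_chebyshev_T_def t_def q_diff_sum[OF q1] q_diff_monomial[OF q1])
  \<comment> \<open>For even \<open>n\<close> the term \<open>k = n div 2\<close> drops out, its factor being \<open>[0] = 0\<close>.\<close>
  also have "\<dots> = (\<Sum>k = 0..(n - 1) div 2. scalar (t k * q_bracket q (n - 2 * k)) * s_var ^ k
           * x_var ^ (n - 2 * k - 1))"
  proof (rule sum.mono_neutral_right)
    show "\<forall>k\<in>{0..n div 2} - {0..(n - 1) div 2}.
        scalar (t k * q_bracket q (n - 2 * k)) * s_var ^ k * x_var ^ (n - 2 * k - 1) = 0"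
    proof
      fix k
      assume "k \<in> {0..n div 2} - {0..(n - 1) div 2}"
      then have "n - 2 * k = 0"
        by auto
      then show "scalar (t k * q_bracket q (n - 2 * k)) * s_var ^ k * x_var ^ (n - 2 * k - 1) = 0"
        by (simp add: q_bracket_def scalar_0)
    qed
  qed (auto intro: div_le_mono)
  also have "\<dots> = (\<Sum>k = 0..(n - 1) div 2. scalar (q_bracket q n)
           * (scalar (u k) * s_var ^ k * x_var ^ (n - 1 - 2 * k)))"
  proof (rule sum.cong)
    fix k
    assume "k \<in> {0..(n - 1) div 2}"
    then have "2 * k < n"
      using assms(2) by auto
    moreover have "n - 2 * k - 1 = n - 1 - 2 * k"
      by simp
    ultimately show "scalar (t k * q_bracket q (n - 2 * k)) * s_var ^ k * x_var ^ (n - 2 * k - 1)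
        = scalar (q_bracket q n) * (scalar (u k) * s_var ^ k * x_var ^ (n - 1 - 2 * k))"
      by (simp only: coeff scalar_mult mult.assoc)
  qed simp
  also have "\<dots> = scalar (q_bracket q n) * q_chebyshev_U q (n - 1)"
    by (simp add: q_chebyshev_U_def u_def sum_distrib_left)
  finally show ?thesis .
qed

lemma q_var_power_neq_1:
  assumes "i \<ge> 1"
  shows "(q_var :: 'k::field poly fract) ^ i \<noteq> 1"
proof -
  have "(q_var :: 'k poly fract) ^ i = to_fract ([:0, 1:] ^ i)"
    by (induction i) (simp_all add: q_var_def del: mult_pCons_left)
  moreover have "([:0, 1:] :: 'k poly) ^ i \<noteq> 1"
  proof
    assume "([:0, 1:] :: 'k poly) ^ i = 1"
    then have "poly ([:0, 1:] ^ i) (0 :: 'k) = 1"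
      by simp
    then show False
      using assms by (simp add: poly_power power_0_left)
  qed
  ultimately show ?thesis
    by (metis to_fract_1 to_fract_eq_iff)
qed

theorem theorem5p7:
  fixes n :: nat
  assumes "n \<ge> 1"
  shows "q_diff (q_var :: 'k::field poly fract) (q_chebyshev_T q_var n)
         = scalar (q_bracket q_var n) * q_chebyshev_U q_var (n - 1)"
  using q_var_power_neq_1 assms by (rule q_diff_q_chebyshev_T)

end
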